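(* Let $L$ be a PG-lattice and let $M$ be a faithful multiplication PG-lattice $L$-module with $I_M$ compact. For a proper element $N\in M$, the following statements are equivalent: (1) $N$ is a pseudo-primary element of $M$. (2) $(N:I_M)$ is a primary element of $L$. (3) $N=qI_M$ for some primary element $q\in L$. (4) $N$ is a primary element of $M$.
   Context: A multiplicative lattice $L$ is a complete lattice (least element $0$, greatest element $1$) with a commutative, associative multiplication that distributes over arbitrary joins and has $1$ as identity. An element $a$ of a complete lattice is compact if $a\leqslant \bigvee X$ implies $a\leqslant x_1\vee\cdots\vee x_n$ for finitely many $x_i\in X$; $L_\ast$ is the set of compact elements of $L$. Standing assumption: every element of $L$ is a join of compact elements of $L$, $1$ is compact, and finite products of compact elements of $L$ are compact. For $a,b\in L$, $(a:b)=\bigvee\{x\in L\mid xb\leqslant a\}$; $Z_+$ is the set of positive integers. An element $e\in L$ is principal if $a\wedge be=((a:e)\wedge b)e$ and $(ae\vee b):e=(b:e)\vee a$ for all $a,b\in L$. $L$ is a PG-lattice if each element of $L$ is a join of principal elements of $L$. An element $q\in L$ with $q<1$ is primary if for all $a,b\in L_\ast$, $ab\leqslant q$ implies $a\leqslant q$ or $b^n\leqslant q$ for some $n\in Z_+$. An $L$-module $M$ is a complete lattice (least element $O_M$, greatest element $I_M$) with a multiplication $L\times M\to M$, $(a,A)\mapsto aA$, such that $(\bigvee_\alpha a_\alpha)A=\bigvee_\alpha a_\alpha A$, $a(\bigvee_\alpha A_\alpha)=\bigvee_\alpha aA_\alpha$, $(ab)A=a(bA)$, $1A=A$, $0A=O_M$.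 For $A,B\in M$, $(A:B)=\bigvee\{x\in L\mid xB\leqslant A\}\in L$. $M$ is faithful if $(O_M:I_M)=0$; $M$ is a multiplication lattice module if every $N\in M$ has the form $N=aI_M$ with $a\in L$. An element $N\in M$ is principal if $(b\wedge(B:N))N=bN\wedge B$ and $b\vee(B:N)=((bN\vee B):N)$ for all $b\in L$, $B\in M$; $M$ is a PG-lattice $L$-module if each element of $M$ is a join of principal elements of $M$. $N\in M$ is proper if $N<I_M$. A proper $N\in M$ is prime if for all $a\in L$, $X\in M$, $aX\leqslant N$ implies $X\leqslant N$ or $aI_M\leqslant N$. A proper $N\in M$ is primary if for all $a\in L$, $X\in M$, $aX\leqslant N$ implies $X\leqslant N$ or $a^nI_M\leqslant N$ for some $n\in Z_+$. For a proper $N$, $rad(N)=\bigwedge\{P\in M\mid P\text{ is prime and }N\leqslant P\}$ (the empty meet is $I_M$). A proper $N\in M$ is pseudo-primary if for all $a\in L$, $X\in M$, $aX\leqslant N$ implies $a\leqslant (N:I_M)$ or $X\leqslant rad(N)$.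
   Formalization: In (4), "primary element of M" is tested only for compact scalars a in L, not for all a in L; with all a the equivalence fails (M=L the ideals of k[s,x_1,x_2,...]/(s^2, s x_i, x_i^{i+1}), N=0). *)

theory Defs
  imports Main
begin

section \<open>Multiplicative lattices\<close>

text \<open>
  The least and greatest elements of a lattice are \<^term>\<open>bot\<close> and \<^term>\<open>top\<close>.
  The multiplicative unit \<open>1\<close> is the greatest element.
\<close>

class multiplicative_lattice = complete_lattice + comm_monoid_mult +
  assumes one_eq_top: "1 = top"
    and mult_Sup: "a * Sup X = (SUP x\<in>X. a * x)"

definition (in complete_lattice) compact_elem :: "'a \<Rightarrow> bool" where
  "compact_elem a \<longleftrightarrow> (\<forall>X. a \<le> Sup X \<longrightarrow> (\<exists>F. finite F \<and> F \<subseteq> X \<and> a \<le> Sup F))"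

context multiplicative_lattice
begin

definition residual :: "'a \<Rightarrow> 'a \<Rightarrow> 'a" where
  "residual a b = Sup {x. x * b \<le> a}"

definition principal_elem :: "'a \<Rightarrow> bool" where
  "principal_elem e \<longleftrightarrow>
     (\<forall>a b. inf a (b * e) = inf (residual a e) b * e \<and>
            residual (sup (a * e) b) e = sup (residual b e) a)"

definition primary_elem :: "'a \<Rightarrow> bool" where
  "primary_elem q \<longleftrightarrow> q < top \<and>
     (\<forall>a b. compact_elem a \<longrightarrow> compact_elem b \<longrightarrow> a * b \<le> q \<longrightarrow>
        a \<le> q \<or> (\<exists>n>0. b ^ n \<le> q))"

end

text \<open>Compactness of the empty product is \<open>compact_top\<close>.\<close>

class compactly_generated_multiplicative_lattice = multiplicative_lattice +
  assumes join_of_compact: "\<exists>C. (\<forall>c\<in>C. compact_elem c) \<and> a = Sup C"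
    and compact_top: "compact_elem top"
    and compact_mult: "compact_elem a \<Longrightarrow> compact_elem b \<Longrightarrow> compact_elem (a * b)"

class pg_lattice = compactly_generated_multiplicative_lattice +
  assumes join_of_principal: "\<exists>E. (\<forall>e\<in>E. principal_elem e) \<and> a = Sup E"


section \<open>Lattice modules\<close>

text \<open>The scalars are the whole type \<open>'l\<close> and the module is the whole type \<open>'m\<close>.\<close>

locale lattice_module =
  fixes smult :: "'l::compactly_generated_multiplicative_lattice \<Rightarrow> 'm::complete_lattice \<Rightarrow> 'm"
    (infixr "\<odot>" 75)
  assumes Sup_smult: "Sup S \<odot> A = (SUP a\<in>S. a \<odot> A)"
    and smult_Sup: "a \<odot> Sup T = (SUP A\<in>T. a \<odot> A)"
    and mult_smult: "(a * b) \<odot> A = a \<odot> (b \<odot> A)"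
    and one_smult: "1 \<odot> A = A"
    and bot_smult: "bot \<odot> A = bot"
begin

definition mod_residual :: "'m \<Rightarrow> 'm \<Rightarrow> 'l" where
  "mod_residual A B = Sup {x. x \<odot> B \<le> A}"

definition faithful :: bool where
  "faithful \<longleftrightarrow> mod_residual bot top = bot"

definition multiplication_module :: bool where
  "multiplication_module \<longleftrightarrow> (\<forall>N. \<exists>a. N = a \<odot> top)"

definition mod_principal :: "'m \<Rightarrow> bool" where
  "mod_principal N \<longleftrightarrow>
     (\<forall>b B. inf b (mod_residual B N) \<odot> N = inf (b \<odot> N) B \<and>
            sup b (mod_residual B N) = mod_residual (sup (b \<odot> N) B) N)"

definition pg_module :: bool where
  "pg_module \<longleftrightarrow> (\<forall>A. \<exists>E. (\<forall>N\<in>E. mod_principal N) \<and> A = Sup E)"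

definition proper :: "'m \<Rightarrow> bool" where
  "proper N \<longleftrightarrow> N < top"

definition mod_prime :: "'m \<Rightarrow> bool" where
  "mod_prime N \<longleftrightarrow> proper N \<and> (\<forall>a X. a \<odot> X \<le> N \<longrightarrow> X \<le> N \<or> a \<odot> top \<le> N)"

text \<open>
  The scalar \<open>a\<close> ranges over the compact elements, as in \<^const>\<open>primary_elem\<close>. With \<open>a\<close>
  ranging over all scalars, primary elements of \<open>M\<close> need not correspond to primary elements
  of \<open>L\<close>, even for \<open>M = L\<close>. Take the ideals of the polynomial ring in
  \<open>s, x\<^sub>1, x\<^sub>2, \<dots>\<close> over a field modulo the relations \<open>s\<^sup>2\<close>, \<open>s x\<^sub>i\<close>, \<open>x\<^sub>i\<^sup>i\<^sup>+\<^sup>1\<close>. Its maximal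
  ideal \<open>m\<close> is nil, so \<open>0\<close> is primary in \<open>L\<close>. But \<open>m s = 0\<close> with \<open>s \<noteq> 0\<close>, and no power of
  \<open>m\<close> vanishes.
\<close>

definition mod_primary :: "'m \<Rightarrow> bool" where
  "mod_primary N \<longleftrightarrow> proper N \<and>
     (\<forall>a X. compact_elem a \<longrightarrow> a \<odot> X \<le> N \<longrightarrow> X \<le> N \<or> (\<exists>n>0. a ^ n \<odot> top \<le> N))"

definition rad :: "'m \<Rightarrow> 'm" where
  "rad N = Inf {P. mod_prime P \<and> N \<le> P}"

definition pseudo_primary :: "'m \<Rightarrow> bool" where
  "pseudo_primary N \<longleftrightarrow> proper N \<and>
     (\<forall>a X. a \<odot> X \<le> N \<longrightarrow> a \<le> mod_residual N top \<or> X \<le> rad N)"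

end

end

theory Submission
  imports Defs
begin

text \<open>
  The map \<open>a \<mapsto> a I\<^sub>M\<close> is an order isomorphism from \<open>L\<close> onto \<open>M\<close>, and it turns the four
  conditions on \<open>N = q I\<^sub>M\<close> into conditions on \<open>q\<close>. To see that it reflects the order, let
  \<open>E\<close> be principal in \<open>M\<close> and \<open>c = (E : I\<^sub>M)\<close>, so \<open>c I\<^sub>M = E\<close>. If \<open>a I\<^sub>M \<le> b I\<^sub>M\<close>, then
  \<open>a E \<le> b E\<close>, hence \<open>a \<le> b \<squnion> (0 : E)\<close>; as \<open>c (0 : E)\<close> annihilates \<open>I\<^sub>M\<close>, this gives
  \<open>c a \<le> b\<close>. It remains to know that the join of all these \<open>c\<close> is \<open>1\<close>. It fixes \<open>I\<^sub>M\<close>, so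
  this is a form of Nakayama's lemma: if \<open>t I\<^sub>M = I\<^sub>M\<close>, then \<open>t E = E\<close> and
  \<open>t \<squnion> (0 : E) = 1\<close> for every principal \<open>E\<close>; finitely many \<open>E\<close> join to \<open>I\<^sub>M\<close> by compactness,
  and the product of their annihilators is \<open>0\<close>.

  Conditions (1) and (2) are then linked by Krull's theorem: a compact element below every prime
  above \<open>q\<close> has a power below \<open>q\<close>.
\<close>

section \<open>Prime elements of a multiplicative lattice\<close>

context multiplicative_lattice
begin

lemma mult_sup: "a * sup b c = sup (a * b) (a * c)"
  using mult_Sup[of a "{b, c}"] by simp

lemma mult_left_mono: "b \<le> c \<Longrightarrow> a * b \<le> a * c"
  by (metis le_iff_sup mult_sup)

lemma mult_mono: "a \<le> b \<Longrightarrow> c \<le> d \<Longrightarrow> a * c \<le> b * d"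
  by (metis mult_left_mono mult.commute order_trans)

lemma mult_le_left: "a * b \<le> a"
  by (metis mult_1_right mult_left_mono one_eq_top top_greatest)

lemma mult_le_right: "a * b \<le> b"
  by (metis mult_le_left mult.commute)

text \<open>After expansion, \<open>x * y\<close> is the only term not already below
  \<open>p\<close>. This serves twice: comaximality with \<open>t\<close> passes to products, and
  the maximal element in Krull's argument is prime.\<close>

lemma sup_mult_sup_le: "sup p x * sup p y \<le> sup p (x * y)"
proof -
  have "sup p x * sup p y = sup (sup p x * p) (sup (p * y) (x * y))"
    by (metis mult_sup mult.commute)
  moreover have "sup p x * p \<le> p" "p * y \<le> p"
    by (rule mult_le_right, rule mult_le_left)
  ultimately show ?thesis
    by (simp add: le_supI1)
qed

lemma sup_prod_eq_top:
  assumes "finite F" and "\<And>i. i \<in> F \<Longrightarrow> sup t (f i) = top"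
  shows "sup t (prod f F) = top"
  using assms
proof (induction F rule: finite_induct)
  case empty
  show ?case by (simp add: one_eq_top)
next
  case (insert i F)
  then have "top = sup t (f i) * sup t (prod f F)"
    by (simp flip: one_eq_top)
  also have "\<dots> \<le> sup t (f i * prod f F)"
    by (rule sup_mult_sup_le)
  finally show ?case
    using insert by (simp add: top_unique)
qed

text \<open>Both factors range over all elements, not only the compact ones, to match the arbitrary
  scalar in \<open>mod_prime\<close>.\<close>

definition prime_elem :: "'a \<Rightarrow> bool" where
  "prime_elem p \<longleftrightarrow> p < top \<and> (\<forall>a b. a * b \<le> p \<longrightarrow> a \<le> p \<or> b \<le> p)"

lemma prime_elem_power_le:
  assumes "prime_elem p" and "b ^ n \<le> p"
  shows "b \<le> p"
  using assms(2)
proof (induction n)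
  case 0
  then show ?case
    by (metis one_eq_top power_0 top_greatest order_trans)
next
  case (Suc n)
  then show ?case
    using assms(1) by (auto simp: prime_elem_def)
qed

end

lemma (in complete_lattice) finite_chain_Sup_in:
  assumes "finite F" "F \<noteq> {}" and "\<And>x y. x \<in> F \<Longrightarrow> y \<in> F \<Longrightarrow> x \<le> y \<or> y \<le> x"
  shows "Sup F \<in> F"
  using assms
proof (induction F rule: finite_ne_induct)
  case (insert x F)
  then have "Sup F \<in> F"
    by blast
  then have "x \<le> Sup F \<or> Sup F \<le> x"
    using insert.prems by blast
  then show ?case
    using \<open>Sup F \<in> F\<close> by (auto simp: sup.absorb1 sup.absorb2)
qed simp

section \<open>Krull's theorem and reformulations of primary elements\<close>

context compactly_generated_multiplicative_lattice
begin

lemma compact_power: "compact_elem a \<Longrightarrow> compact_elem (a ^ n)"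
proof (induction n)
  case 0
  show ?case
    by (metis power_0 one_eq_top compact_top)
qed (simp add: compact_mult)

lemma le_if_compact_le:
  assumes "\<And>c. compact_elem c \<Longrightarrow> c \<le> a \<Longrightarrow> c \<le> b"
  shows "a \<le> b"
proof -
  obtain C where "\<forall>c\<in>C. compact_elem c" "a = Sup C"
    using join_of_compact by blast
  then show ?thesis
    using assms by (auto intro: Sup_least Sup_upper)
qed

text \<open>Krull's argument: Zorn's lemma yields a maximal element among those above
  \<open>q\<close> and above no power of \<open>b\<close>, and maximality makes it prime.
  Compactness of the powers of \<open>b\<close> provides upper bounds of chains.\<close>

lemma exists_prime_above_avoiding_powers:
  assumes "compact_elem b" and "\<And>n. \<not> b ^ n \<le> q"
  obtains p where "prime_elem p" "q \<le> p" "\<not> b \<le> p"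
proof -
  define S where "S = {x. q \<le> x \<and> (\<forall>n. \<not> b ^ n \<le> x)}"
  have "\<exists>m\<in>S. \<forall>a\<in>S. m \<le> a \<longrightarrow> a = m"
  proof (rule predicate_Zorn)
    show "partial_order_on S (relation_of (\<le>) S)"
      by (rule partial_order_on_relation_ofI) auto
  next
    fix C assume C: "C \<in> Chains (relation_of (\<le>) S)"
    then have "C \<subseteq> S" and chain: "\<And>x y. x \<in> C \<Longrightarrow> y \<in> C \<Longrightarrow> x \<le> y \<or> y \<le> x"
      by (auto simp: Chains_def relation_of_def)
    have "q \<in> S"
      using assms(2) by (simp add: S_def)
    \<comment> \<open>Inserting \<open>q\<close> keeps the join above \<open>q\<close> even when the
      chain is empty.\<close>
    have "\<not> b ^ n \<le> Sup (insert q C)" for n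
    proof
      assume le: "b ^ n \<le> Sup (insert q C)"
      obtain F where F: "finite F" "F \<subseteq> insert q C" "b ^ n \<le> Sup F"
        using le compact_power[OF assms(1), of n] unfolding compact_elem_def by blast
      have "F \<noteq> {}"
      proof
        assume "F = {}"
        then have "b ^ n \<le> q"
          using F(3) by (metis Sup_empty bot_least order_trans)
        then show False
          using assms(2) by blast
      qed
      have "Sup F \<in> F"
      proof (rule finite_chain_Sup_in[OF F(1) \<open>F \<noteq> {}\<close>])
        fix x y assume "x \<in> F" "y \<in> F"
        then show "x \<le> y \<or> y \<le> x"
          using F(2) \<open>C \<subseteq> S\<close> chain unfolding S_def by blast
      qed
      then have "Sup F \<in> S"
        using F(2) \<open>C \<subseteq> S\<close> \<open>q \<in> S\<close> by blast
      then show False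
        using F(3) by (simp add: S_def)
    qed
    then have "Sup (insert q C) \<in> S"
      unfolding S_def by simp
    then show "\<exists>u\<in>S. \<forall>a\<in>C. a \<le> u"
      by (meson Sup_upper insertI2)
  qed
  then obtain p where p: "q \<le> p" "\<And>n. \<not> b ^ n \<le> p"
    and max: "\<And>x. q \<le> x \<Longrightarrow> (\<And>n. \<not> b ^ n \<le> x) \<Longrightarrow> p \<le> x \<Longrightarrow> x = p"
    unfolding S_def by blast
  \<comment> \<open>Here \<open>sup p x\<close> is strictly above \<open>p\<close>, so by maximality
    it has left \<open>S\<close>.\<close>
  have grow: "\<exists>n. b ^ n \<le> sup p x" if "\<not> x \<le> p" for x
    using max[of "sup p x"] p(1) that by (metis le_supI1 sup_ge1 sup_ge2)
  have "prime_elem p"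
    unfolding prime_elem_def
  proof (intro conjI allI impI)
    \<comment> \<open>The exponent 0 is included in \<open>S\<close>, so \<open>p\<close> is not
      above \<open>b ^ 0 = 1\<close>.\<close>
    show "p < top"
      using p(2)[of 0] by (metis one_eq_top power_0 top.not_eq_extremum order_refl)
    fix x y assume "x * y \<le> p"
    show "x \<le> p \<or> y \<le> p"
    proof (rule ccontr)
      assume "\<not> (x \<le> p \<or> y \<le> p)"
      then obtain m n where "b ^ m \<le> sup p x" "b ^ n \<le> sup p y"
        using grow by blast
      then have "b ^ (m + n) \<le> sup p (x * y)"
        unfolding power_add using mult_mono sup_mult_sup_le order_trans by blast
      then show False
        using p(2) \<open>x * y \<le> p\<close> by (metis sup.absorb1)
    qed
  qed
  moreover have "\<not> b \<le> p"
    using p(2)[of 1] by simp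
  ultimately show ?thesis
    using that p(1) by blast
qed

lemma compact_power_le_iff_below_primes:
  assumes "compact_elem b"
  shows "(\<exists>n>0. b ^ n \<le> q) \<longleftrightarrow> (\<forall>p. prime_elem p \<longrightarrow> q \<le> p \<longrightarrow> b \<le> p)"
proof
  assume "\<exists>n>0. b ^ n \<le> q"
  then show "\<forall>p. prime_elem p \<longrightarrow> q \<le> p \<longrightarrow> b \<le> p"
    by (meson prime_elem_power_le order_trans)
next
  assume "\<forall>p. prime_elem p \<longrightarrow> q \<le> p \<longrightarrow> b \<le> p"
  then obtain n where "b ^ n \<le> q"
    using exists_prime_above_avoiding_powers[OF assms] by metis
  \<comment> \<open>The exponent \<open>n\<close> may be 0; one more factor makes it
    positive.\<close>
  then have "b ^ Suc n \<le> q"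
    by (metis mult_le_right order_trans power_Suc)
  then show "\<exists>n>0. b ^ n \<le> q"
    by blast
qed

text \<open>Lying below every prime above \<open>q\<close> passes from the compact elements below
  \<open>b\<close> to \<open>b\<close> itself, whereas having a power below \<open>q\<close> need
  not. Krull's theorem therefore lets \<open>a\<close> and \<open>b\<close> range over all elements,
  as in \<open>pseudo_primary\<close>.\<close>

lemma primary_elem_iff_primes:
  "primary_elem q \<longleftrightarrow>
     q < top \<and> (\<forall>a b. a * b \<le> q \<longrightarrow> a \<le> q \<or> (\<forall>p. prime_elem p \<longrightarrow> q \<le> p \<longrightarrow> b \<le> p))"
  (is "?P \<longleftrightarrow> ?Q")
proof
  assume P: ?P
  have "b \<le> p" if "a * b \<le> q" "\<not> a \<le> q" "prime_elem p" "q \<le> p" for a b p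
  proof (rule le_if_compact_le)
    fix d assume d: "compact_elem d" "d \<le> b"
    obtain c where c: "compact_elem c" "c \<le> a" "\<not> c \<le> q"
      using le_if_compact_le \<open>\<not> a \<le> q\<close> by blast
    have "c * d \<le> q"
      using mult_mono[OF c(2) d(2)] \<open>a * b \<le> q\<close> by (rule order_trans)
    then have "\<exists>n>0. d ^ n \<le> q"
      using P c d unfolding primary_elem_def by blast
    then show "d \<le> p"
      using that compact_power_le_iff_below_primes[OF d(1)] by blast
  qed
  then show ?Q
    using P unfolding primary_elem_def by blast
next
  assume ?Q
  then show ?P
    unfolding primary_elem_def using compact_power_le_iff_below_primes by blast
qed

text \<open>This is the shape of \<open>mod_primary\<close>: a compact scalar carries the power, and
  the other factor is arbitrary.\<close>

lemma primary_elem_iff_left_compact: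
  "primary_elem q \<longleftrightarrow>
     q < top \<and> (\<forall>a b. compact_elem a \<longrightarrow> a * b \<le> q \<longrightarrow> b \<le> q \<or> (\<exists>n>0. a ^ n \<le> q))"
  (is "?P \<longleftrightarrow> ?Q")
proof
  assume ?P
  then show ?Q
    unfolding primary_elem_iff_primes using compact_power_le_iff_below_primes
    by (metis mult.commute)
next
  assume ?Q
  then show ?P
    unfolding primary_elem_def by (metis mult.commute)
qed

end


section \<open>Faithful multiplication modules\<close>

context lattice_module
begin

lemma sup_smult: "sup a b \<odot> A = sup (a \<odot> A) (b \<odot> A)"
  using Sup_smult[of "{a, b}" A] by simp

lemma smult_sup: "a \<odot> sup A B = sup (a \<odot> A) (a \<odot> B)"
  using smult_Sup[of a "{A, B}"] by simp

lemma smult_mono_left: "a \<le> b \<Longrightarrow> a \<odot> A \<le> b \<odot> A"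
  by (metis le_iff_sup sup_smult)

lemma smult_mono_right: "A \<le> B \<Longrightarrow> a \<odot> A \<le> a \<odot> B"
  by (metis le_iff_sup smult_sup)

lemma smult_left_commute: "a \<odot> b \<odot> A = b \<odot> a \<odot> A"
  by (metis mult.commute mult_smult)

lemma mod_residual_smult_le: "mod_residual A B \<odot> B \<le> A"
  unfolding mod_residual_def Sup_smult by (auto intro: SUP_least)

lemma le_mod_residual_iff: "a \<le> mod_residual A B \<longleftrightarrow> a \<odot> B \<le> A"
proof
  assume "a \<le> mod_residual A B"
  then show "a \<odot> B \<le> A"
    using smult_mono_left mod_residual_smult_le order_trans by blast
next
  assume "a \<odot> B \<le> A"
  then show "a \<le> mod_residual A B"
    unfolding mod_residual_def by (simp add: Sup_upper)
qed

lemma mod_principal_residual_smult: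
  assumes "mod_principal E"
  shows "mod_residual (b \<odot> E) E = sup b (mod_residual bot E)"
  using assms unfolding mod_principal_def by (metis sup_bot_right)

lemma faithful_iff: "faithful \<longleftrightarrow> (\<forall>a. a \<odot> top = bot \<longrightarrow> a = bot)"
  unfolding faithful_def by (metis le_mod_residual_iff bot_unique order_refl bot_smult)

end

locale faithful_multiplication_lattice_module = lattice_module +
  assumes faithful: faithful
    and multiplication_module: multiplication_module
    and pg_module: pg_module
    and compact_module_top: "compact_elem (top :: 'b)"
begin

section \<open>The order isomorphism between \<open>L\<close> and \<open>M\<close>\<close>

lemma mod_residual_top_smult: "mod_residual A top \<odot> top = A"
proof -
  obtain a where "A = a \<odot> top"
    using multiplication_module unfolding multiplication_module_def by blast
  then show ?thesis
    by (metis le_mod_residual_iff smult_mono_left mod_residual_smult_le order_refl order_antisym)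
qed

lemma smult_eq_if_smult_top_eq_top:
  assumes "t \<odot> top = top"
  shows "t \<odot> A = A"
proof -
  have "t \<odot> mod_residual A top \<odot> top = mod_residual A top \<odot> t \<odot> top"
    by (rule smult_left_commute)
  then show ?thesis
    by (simp only: assms mod_residual_top_smult)
qed

lemma Sup_mod_principal_eq_top: "Sup {E. mod_principal E} = top"
proof -
  obtain G where G: "\<forall>E\<in>G. mod_principal E" "top = Sup G"
    using pg_module unfolding pg_module_def by blast
  have "Sup G \<le> Sup {E. mod_principal E}"
    using G(1) by (intro Sup_subset_mono) blast
  then show ?thesis
    by (simp add: top_le flip: G(2))
qed

lemma eq_top_if_smult_top_eq_top:
  assumes "t \<odot> top = top"
  shows "t = top"
proof -
  obtain F where F: "finite F" "F \<subseteq> {E. mod_principal E}" "top \<le> Sup F"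
    using compact_module_top unfolding compact_elem_def
    by (metis Sup_mod_principal_eq_top order_refl)
  \<comment> \<open>A product of annihilators: it kills every \<open>E\<close> in \<open>F\<close>,
    hence their join \<open>top\<close>.\<close>
  define u where "u = (\<Prod>E\<in>F. mod_residual bot E)"
  have "sup t (mod_residual bot E) = top" if "E \<in> F" for E
  proof -
    have "mod_principal E"
      using F(2) that by blast
    then have "sup t (mod_residual bot E) = mod_residual (t \<odot> E) E"
      by (simp add: mod_principal_residual_smult)
    also have "\<dots> = top"
      unfolding smult_eq_if_smult_top_eq_top[OF assms]
      by (rule top_le) (simp add: le_mod_residual_iff one_smult flip: one_eq_top)
    finally show ?thesis .
  qed
  then have "sup t u = top"
    unfolding u_def using F(1) by (rule sup_prod_eq_top[rotated])
  moreover have "u \<odot> E = bot" if "E \<in> F" for E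
  proof -
    have "u \<le> mod_residual bot E"
      unfolding u_def prod.remove[OF F(1) that] by (rule mult_le_left)
    then show ?thesis
      by (simp add: le_mod_residual_iff bot_unique)
  qed
  then have "u \<odot> Sup F = bot"
    unfolding smult_Sup by (simp add: SUP_bot_conv)
  then have "u = bot"
    using faithful top_le[OF F(3)] unfolding faithful_iff by simp
  ultimately show ?thesis
    by simp
qed

lemma Sup_mod_residual_principal_eq_top: "(SUP E\<in>{E. mod_principal E}. mod_residual E top) = top"
proof (rule eq_top_if_smult_top_eq_top)
  show "(SUP E\<in>{E. mod_principal E}. mod_residual E top) \<odot> top = top"
    unfolding Sup_smult image_image mod_residual_top_smult
    by (simp add: Sup_mod_principal_eq_top)
qed

lemma smult_top_le_iff: "a \<odot> top \<le> b \<odot> top \<longleftrightarrow> a \<le> b"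
proof
  assume le: "a \<odot> top \<le> b \<odot> top"
  \<comment> \<open>The scalars \<open>mod_residual E top\<close> join to 1, so these bounds
    together give \<open>a \<le> b\<close>.\<close>
  have "a * mod_residual E top \<le> b" if E: "mod_principal E" for E
  proof -
    define c where "c = mod_residual E top"
    define z where "z = mod_residual bot E"
    have c: "c \<odot> top = E"
      unfolding c_def by (rule mod_residual_top_smult)
    \<comment> \<open>Multiplying \<open>le\<close> by \<open>c\<close> replaces \<open>top\<close>
      by the principal \<open>E\<close>, which can be cancelled up to its annihilator
      \<open>z\<close>.\<close>
    have "a \<odot> E \<le> b \<odot> E"
      by (metis c le smult_left_commute smult_mono_right)
    then have "a \<le> sup b z"
      unfolding z_def by (metis E mod_principal_residual_smult le_mod_residual_iff)
    then have "c * a \<le> sup (c * b) (c * z)"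
      by (metis mult_left_mono mult_sup)
    moreover have "c * z = bot"
    proof -
      have "(c * z) \<odot> top = z \<odot> E"
        by (metis c mult_smult smult_left_commute)
      also have "\<dots> = bot"
        unfolding z_def using mod_residual_smult_le bot_unique by blast
      finally show ?thesis
        using faithful unfolding faithful_iff by blast
    qed
    moreover have "c * b \<le> b"
      by (rule mult_le_right)
    ultimately show ?thesis
      unfolding c_def by (metis mult.commute order_trans sup_bot_right)
  qed
  then have "a * (SUP E\<in>{E. mod_principal E}. mod_residual E top) \<le> b"
    unfolding mult_Sup image_image by (simp add: SUP_le_iff)
  then show "a \<le> b"
    unfolding Sup_mod_residual_principal_eq_top by (simp flip: one_eq_top)
qed (rule smult_mono_left)

section \<open>Transfer of the module notions to \<open>L\<close>\<close>

lemma mod_residual_smult_top: "mod_residual (a \<odot> top) top = a"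
  by (metis mod_residual_top_smult smult_top_le_iff order_antisym order_refl)

lemma all_module_iff: "(\<forall>X. P X) \<longleftrightarrow> (\<forall>x. P (x \<odot> top))"
  by (metis mod_residual_top_smult)

text \<open>Strictness is the Nakayama step: only the scalar 1 fixes \<open>top\<close>.\<close>

lemma proper_smult_top_iff: "proper (a \<odot> top) \<longleftrightarrow> a < top"
  unfolding proper_def
  by (metis eq_top_if_smult_top_eq_top one_eq_top one_smult top.not_eq_extremum)

lemma smult_smult_top_le_iff: "a \<odot> b \<odot> top \<le> c \<odot> top \<longleftrightarrow> a * b \<le> c"
  by (simp add: smult_top_le_iff flip: mult_smult)

lemma mod_prime_smult_top_iff: "mod_prime (p \<odot> top) \<longleftrightarrow> prime_elem p"
  unfolding mod_prime_def prime_elem_def all_module_iff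
    proper_smult_top_iff smult_smult_top_le_iff smult_top_le_iff by blast

lemma smult_top_le_rad_iff:
  "b \<odot> top \<le> rad (q \<odot> top) \<longleftrightarrow> (\<forall>p. prime_elem p \<longrightarrow> q \<le> p \<longrightarrow> b \<le> p)"
proof -
  have "b \<odot> top \<le> rad (q \<odot> top) \<longleftrightarrow>
      (\<forall>P. mod_prime P \<longrightarrow> q \<odot> top \<le> P \<longrightarrow> b \<odot> top \<le> P)"
    unfolding rad_def le_Inf_iff by blast
  then show ?thesis
    unfolding all_module_iff mod_prime_smult_top_iff smult_top_le_iff .
qed

lemma pseudo_primary_smult_top_iff: "pseudo_primary (q \<odot> top) \<longleftrightarrow> primary_elem q"
  unfolding pseudo_primary_def primary_elem_iff_primes all_module_iff proper_smult_top_iff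
    mod_residual_smult_top smult_smult_top_le_iff smult_top_le_rad_iff ..

lemma mod_primary_smult_top_iff: "mod_primary (q \<odot> top) \<longleftrightarrow> primary_elem q"
  unfolding mod_primary_def primary_elem_iff_left_compact all_module_iff proper_smult_top_iff
    smult_smult_top_le_iff smult_top_le_iff ..

end

theorem theorem2p14:
  fixes smult :: "'l::pg_lattice \<Rightarrow> 'm::complete_lattice \<Rightarrow> 'm"
    and N :: 'm
  assumes "lattice_module smult"
    and "lattice_module.faithful smult"
    and "lattice_module.multiplication_module smult"
    and "lattice_module.pg_module smult"
    and "compact_elem (top :: 'm)"
    and "lattice_module.proper N"
  shows "(lattice_module.pseudo_primary smult N
            \<longleftrightarrow> primary_elem (lattice_module.mod_residual smult N top))
       \<and> (primary_elem (lattice_module.mod_residual smult N top)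
            \<longleftrightarrow> (\<exists>q. primary_elem q \<and> N = smult q top))
       \<and> ((\<exists>q. primary_elem q \<and> N = smult q top)
            \<longleftrightarrow> lattice_module.mod_primary smult N)"
proof -
  interpret lattice_module smult
    by (rule assms(1))
  interpret faithful_multiplication_lattice_module smult
    by unfold_locales (rule assms)+
  have N: "N = smult (mod_residual N top) top"
    by (rule mod_residual_top_smult[symmetric])
  have "pseudo_primary N \<longleftrightarrow> primary_elem (mod_residual N top)"
    using pseudo_primary_smult_top_iff[of "mod_residual N top"] by (simp flip: N)
  moreover have "mod_primary N \<longleftrightarrow> primary_elem (mod_residual N top)"
    using mod_primary_smult_top_iff[of "mod_residual N top"] by (simp flip: N)
  \<comment> \<open>The scalar \<open>q\<close> with \<open>N = smult q top\<close> is unique,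
    namely \<open>mod_residual N top\<close>.\<close>
  moreover have "(\<exists>q. primary_elem q \<and> N = smult q top) \<longleftrightarrow> primary_elem (mod_residual N top)"
    using N mod_residual_smult_top by metis
  ultimately show ?thesis
    by blast
qed

end
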